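(* Let $m\ge 3$ and $n\ge 1$ be integers and let $T_{m,n}$ be the $(m,n)$-tadpole graph. Then $$\mathcal{L}(T_{m,n})=2^{m-2}\left(\binom{m+n}{n+1}+\sum_{k=0}^{n-1}\binom{m+n-1}{k+m}\right).$$
   Context: Let $H$ be a finite, connected, undirected graph with vertex set $V$. A random walk labeling of $H$ is a labeling of $V$ obtainable by the following process: (1) set $i=1$, choose any $v\in V$ and label $v$ with $i$; (2) as long as there are unlabeled vertices, choose a vertex $w$ adjacent to the current vertex $v$ and replace $v$ by $w$; if this new $v$ is not labeled, increase $i$ by $1$ and label $v$ with $i$. The number of different random walk labelings of $H$ is denoted by $\mathcal{L}(H)$. The $(m,n)$-tadpole graph $T_{m,n}$ is obtained from the disjoint union of the cycle graph $C_m$ on $m$ vertices and the path graph $P_n$ on $n$ vertices by adding a single edge (a bridge) between a vertex of $C_m$ and an end vertex of $P_n$. *)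

theory Defs
  imports "Graph_Theory.Graph_Theory"
begin

text \<open>
  Undirected graphs are symmetric digraphs, as in the locales \<open>graph\<close> and \<open>pair_graph\<close>;
  an edge between u and v is the pair of arcs (u,v) and (v,u).

  A state (v, f, i) of the labeling process consists of the current vertex v, the labels
  f given so far (\<open>None\<close> on unlabeled vertices), and the current value of the counter i.
\<close>

inductive rw_state :: "('a, 'b) pre_digraph \<Rightarrow> 'a \<Rightarrow> ('a \<rightharpoonup> nat) \<Rightarrow> nat \<Rightarrow> bool"
  for H :: "('a, 'b) pre_digraph" where
  start: "v \<in> verts H \<Longrightarrow> rw_state H v [v \<mapsto> 1] 1"
| revisit: "rw_state H v f i \<Longrightarrow> \<exists>u\<in>verts H. f u = None \<Longrightarrow> v \<rightarrow>\<^bsub>H\<^esub> w \<Longrightarrow> f w \<noteq> None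
    \<Longrightarrow> rw_state H w f i"
| discover: "rw_state H v f i \<Longrightarrow> \<exists>u\<in>verts H. f u = None \<Longrightarrow> v \<rightarrow>\<^bsub>H\<^esub> w \<Longrightarrow> f w = None
    \<Longrightarrow> rw_state H w (f(w \<mapsto> i + 1)) (i + 1)"

definition random_walk_labelings :: "('a, 'b) pre_digraph \<Rightarrow> ('a \<rightharpoonup> nat) set" where
  "random_walk_labelings H = {f. (\<exists>v i. rw_state H v f i) \<and> (\<forall>u\<in>verts H. f u \<noteq> None)}"

definition num_random_walk_labelings :: "('a, 'b) pre_digraph \<Rightarrow> nat" where
  "num_random_walk_labelings H = card (random_walk_labelings H)"

text \<open>For m at least 3 this is the cycle on m vertices.\<close>

definition cycle_graph :: "nat \<Rightarrow> nat pair_pre_digraph" where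
  "cycle_graph m = \<lparr> pverts = {..<m},
     parcs = {(i, j). i < m \<and> j < m \<and> (j = Suc i mod m \<or> i = Suc j mod m)} \<rparr>"

definition path_graph :: "nat \<Rightarrow> nat pair_pre_digraph" where
  "path_graph n = \<lparr> pverts = {..<n},
     parcs = {(i, j). i < n \<and> j < n \<and> (j = Suc i \<or> i = Suc j)} \<rparr>"

definition disjoint_union_graph ::
  "'a pair_pre_digraph \<Rightarrow> 'b pair_pre_digraph \<Rightarrow> ('a + 'b) pair_pre_digraph" where
  "disjoint_union_graph G H = \<lparr> pverts = pverts G <+> pverts H,
     parcs = map_prod Inl Inl ` parcs G \<union> map_prod Inr Inr ` parcs H \<rparr>"

definition add_edge :: "'a pair_pre_digraph \<Rightarrow> 'a \<Rightarrow> 'a \<Rightarrow> 'a pair_pre_digraph" where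
  "add_edge G u v = G\<lparr> parcs := parcs G \<union> {(u, v), (v, u)} \<rparr>"

text \<open>
  The bridge joins vertex 0 of the cycle to the end vertex 0 of the path; every other
  choice of the two attachment vertices gives an isomorphic graph.
\<close>

definition tadpole_graph :: "nat \<Rightarrow> nat \<Rightarrow> (nat + nat) pair_pre_digraph" where
  "tadpole_graph m n =
     add_edge (disjoint_union_graph (cycle_graph m) (path_graph n)) (Inl 0) (Inr 0)"

lemma pverts_tadpole_graph: "pverts (tadpole_graph m n) = Inl ` {..<m} \<union> Inr ` {..<n}"
  by (auto simp: tadpole_graph_def add_edge_def disjoint_union_graph_def cycle_graph_def
      path_graph_def Plus_def)

lemma parcs_tadpole_graph_iff:
  "(Inl i, Inl j) \<in> parcs (tadpole_graph m n) \<longleftrightarrow>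
     i < m \<and> j < m \<and> (j = Suc i mod m \<or> i = Suc j mod m)"
  "(Inr k, Inr l) \<in> parcs (tadpole_graph m n) \<longleftrightarrow> k < n \<and> l < n \<and> (l = Suc k \<or> k = Suc l)"
  "(Inl i, Inr l) \<in> parcs (tadpole_graph m n) \<longleftrightarrow> i = 0 \<and> l = 0"
  "(Inr k, Inl j) \<in> parcs (tadpole_graph m n) \<longleftrightarrow> j = 0 \<and> k = 0"
  by (auto simp: tadpole_graph_def add_edge_def disjoint_union_graph_def cycle_graph_def
      path_graph_def)

lemma pair_graph_tadpole_graph:
  assumes "m \<ge> 3" "n \<ge> 1"
  shows "pair_graph (tadpole_graph m n)"
proof -
  have wf: "fst e \<in> pverts (tadpole_graph m n) \<and> snd e \<in> pverts (tadpole_graph m n)"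
    if "e \<in> parcs (tadpole_graph m n)" for e
    using that assms
    by (cases e; cases "fst e"; cases "snd e")
      (auto simp: pverts_tadpole_graph parcs_tadpole_graph_iff)
  have fin: "finite (pverts (tadpole_graph m n))"
    by (simp add: pverts_tadpole_graph)
  have "parcs (tadpole_graph m n) \<subseteq> pverts (tadpole_graph m n) \<times> pverts (tadpole_graph m n)"
    using wf by (auto simp: mem_Times_iff)
  then have fin': "finite (parcs (tadpole_graph m n))"
    using fin by (meson finite_SigmaI finite_subset)
  have neq: "Suc i mod m \<noteq> i" if "i < m" for i
    using that assms by (cases "Suc i = m") auto
  have loop: "fst e \<noteq> snd e" if "e \<in> parcs (tadpole_graph m n)" for e
    using that neq
    by (cases e; cases "fst e"; cases "snd e") (force simp: parcs_tadpole_graph_iff)+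
  have "(b, a) \<in> parcs (tadpole_graph m n)" if "(a, b) \<in> parcs (tadpole_graph m n)" for a b
    using that by (cases a; cases b) (auto simp: parcs_tadpole_graph_iff)
  then have sym: "symmetric (tadpole_graph m n)"
    by (auto simp: symmetric_def intro: symI)
  show ?thesis
    using wf fin fin' loop sym by unfold_locales auto
qed

lemma connected_tadpole_graph:
  assumes "m \<ge> 3" "n \<ge> 1"
  shows "connected (tadpole_graph m n)"
proof -
  let ?T = "tadpole_graph m n"
  interpret pair_graph ?T using assms by (rule pair_graph_tadpole_graph)
  have cyc: "Inl 0 \<rightarrow>\<^sup>*\<^bsub>?T\<^esub> Inl i" if "i < m" for i
    using that
  proof (induction i)
    case 0
    then show ?case by (simp add: pverts_tadpole_graph)
  next
    case (Suc i)
    then have "Inl i \<rightarrow>\<^bsub>?T\<^esub> Inl (Suc i)" by (simp add: parcs_tadpole_graph_iff)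
    with Suc show ?case by (metis Suc_lessD reachable_adj_trans with_proj_simps(3))
  qed
  have path: "Inl 0 \<rightarrow>\<^sup>*\<^bsub>?T\<^esub> Inr k" if "k < n" for k
    using that
  proof (induction k)
    case 0
    have "Inl 0 \<rightarrow>\<^bsub>?T\<^esub> Inr 0" by (simp add: parcs_tadpole_graph_iff)
    then show ?case by (metis reachable_adjI with_proj_simps(3))
  next
    case (Suc k)
    then have "Inr k \<rightarrow>\<^bsub>?T\<^esub> Inr (Suc k)" by (simp add: parcs_tadpole_graph_iff)
    with Suc show ?case by (metis Suc_lessD reachable_adj_trans with_proj_simps(3))
  qed
  have root: "Inl 0 \<rightarrow>\<^sup>*\<^bsub>?T\<^esub> u" if "u \<in> pverts ?T" for u
    using that cyc path by (auto simp: pverts_tadpole_graph)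
  have "u \<rightarrow>\<^sup>*\<^bsub>?T\<^esub> v" if "u \<in> pverts ?T" "v \<in> pverts ?T" for u v
    using root that symmetric_reachable[OF pair_sym_arcs] reachable_trans by metis
  moreover have "Inl 0 \<in> pverts ?T" using assms by (simp add: pverts_tadpole_graph)
  ultimately have "strongly_connected ?T" by (auto simp: strongly_connected_def)
  then show ?thesis
    using pair_sym_arcs by (simp add: connected_def strongly_connected_def
        reachable_mk_symmetric_eq)
qed

end

(*
  A walk can revisit labeled vertices freely, so random walk labelings correspond to the orderings
  of the vertices all of whose prefixes are connected. Such orderings are counted by recursion on
  the set of vertices still unlabeled. In the tadpole graph, once the vertex of degree three is
  labeled, r unlabeled cycle vertices and s unlabeled path vertices can be completed in
  2^(r-1) * binomial(r+s, s) ways: interleave the two parts, and choose an end of the remaining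
  arc each time a cycle vertex is taken, except for the last one. A start in the path interleaves
  the outer part of the path with everything else, which yields the sum over k. For starts in the
  cycle, the sum over all arcs of a fixed length that avoid the vertex of degree three satisfies
  a Pascal-type recursion.
*)

theory Submission
  imports Defs
begin

section \<open>Labelings as orderings with connected prefixes\<close>

definition labeling_of :: "'a list \<Rightarrow> ('a \<rightharpoonup> nat)" where
  "labeling_of xs = map_of (zip xs [1..<Suc (length xs)])"

lemma labeling_of_single: "labeling_of [v] = [v \<mapsto> 1]"
  by (simp add: labeling_of_def)

lemma dom_labeling_of: "dom (labeling_of xs) = set xs"
  by (simp add: labeling_of_def dom_map_of_zip del: upt_Suc)

lemma labeling_of_eq_None_iff: "labeling_of xs u = None \<longleftrightarrow> u \<notin> set xs"
  using dom_labeling_of[of xs] by (auto simp: domIff)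

lemma labeling_of_snoc:
  assumes "w \<notin> set xs"
  shows "labeling_of (xs @ [w]) = (labeling_of xs)(w \<mapsto> length xs + 1)"
proof -
  have "labeling_of (xs @ [w]) = [w \<mapsto> length xs + 1] ++ labeling_of xs"
    by (simp add: labeling_of_def upt_Suc_append[of "Suc 0" "Suc (length xs)"] del: upt_Suc)
  also have "\<dots> = (labeling_of xs)(w \<mapsto> length xs + 1)"
    using assms labeling_of_eq_None_iff[of xs w]
    by (auto simp: fun_eq_iff map_add_def split: option.splits)
  finally show ?thesis .
qed

lemma labeling_of_nth:
  assumes "distinct xs" "i < length xs"
  shows "labeling_of xs (xs ! i) = Some (Suc i)"
  using assms by (simp add: labeling_of_def map_of_zip_nth del: upt_Suc)

text \<open>The domain recovers the vertex set and each label recovers a position, so counting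
  labelings becomes counting lists.\<close>

lemma labeling_of_inj:
  assumes "distinct xs" "distinct ys" "labeling_of xs = labeling_of ys"
  shows "xs = ys"
proof (rule nth_equalityI)
  have "set xs = set ys"
    using assms(3) dom_labeling_of[of xs] dom_labeling_of[of ys] by simp
  then show "length xs = length ys"
    using distinct_card[OF assms(1)] distinct_card[OF assms(2)] by simp
  fix i assume i: "i < length xs"
  then have "xs ! i \<in> set ys"
    using \<open>set xs = set ys\<close> nth_mem by blast
  then obtain j where j: "j < length ys" "ys ! j = xs ! i"
    by (auto simp: in_set_conv_nth)
  then have "Suc j = Suc i"
    using labeling_of_nth[OF assms(1) i] labeling_of_nth[OF assms(2) j(1)] assms(3) by simp
  with j show "xs ! i = ys ! i" by simp
qed

text \<open>The source \<open>s\<close> may be any listed vertex, not just the last one: before its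
  next discovery the walk can return to every labeled vertex, so its position is forgotten.\<close>

inductive grown :: "('a, 'b) pre_digraph \<Rightarrow> 'a list \<Rightarrow> bool" for G where
  single: "v \<in> verts G \<Longrightarrow> grown G [v]"
| snoc: "grown G xs \<Longrightarrow> s \<in> set xs \<Longrightarrow> s \<rightarrow>\<^bsub>G\<^esub> w \<Longrightarrow> w \<notin> set xs \<Longrightarrow> grown G (xs @ [w])"

lemma grown_not_Nil: "grown G xs \<Longrightarrow> xs \<noteq> []"
  by (induction rule: grown.induct) auto

lemma grown_distinct: "grown G xs \<Longrightarrow> distinct xs"
  by (induction rule: grown.induct) auto

lemma grown_snoc_iff:
  assumes "xs \<noteq> []"
  shows "grown G (xs @ [w]) \<longleftrightarrow> grown G xs \<and> (\<exists>s\<in>set xs. s \<rightarrow>\<^bsub>G\<^esub> w) \<and> w \<notin> set xs"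
proof
  assume "grown G (xs @ [w])"
  then show "grown G xs \<and> (\<exists>s\<in>set xs. s \<rightarrow>\<^bsub>G\<^esub> w) \<and> w \<notin> set xs"
    using assms by cases auto
qed (auto intro: grown.snoc)

lemma grown_prefix: "grown G (xs @ ys) \<Longrightarrow> xs \<noteq> [] \<Longrightarrow> grown G xs"
proof (induction ys rule: rev_induct)
  case (snoc y ys)
  then show ?case
    using grown_snoc_iff[of "xs @ ys" G y] by simp
qed simp

context sym_digraph
begin

lemma grown_subset: "grown G xs \<Longrightarrow> set xs \<subseteq> verts G"
  by (induction rule: grown.induct) auto

lemma rw_state_grown:
  assumes "rw_state G v f i"
  shows "\<exists>xs. grown G xs \<and> v \<in> set xs \<and> f = labeling_of xs \<and> i = length xs"
  using assms
proof induction
  case (start v)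
  then show ?case
    by (intro exI[of _ "[v]"]) (simp add: grown.single labeling_of_single)
next
  case (revisit v f i w)
  then obtain xs where "grown G xs" "f = labeling_of xs" "i = length xs"
    by auto
  moreover from this revisit have "w \<in> set xs"
    using labeling_of_eq_None_iff[of xs w] by simp
  ultimately show ?case by blast
next
  case (discover v f i w)
  then obtain xs where xs: "grown G xs" "v \<in> set xs" "f = labeling_of xs" "i = length xs"
    by auto
  with discover have "w \<notin> set xs"
    by (simp add: labeling_of_eq_None_iff)
  with xs discover show ?case
    by (intro exI[of _ "xs @ [w]"]) (auto simp: labeling_of_snoc intro: grown.snoc)
qed

text \<open>The relation constrains only targets because a \<open>revisit\<close> step checks only
  the label of its target. In the induction, symmetry of the arcs attaches \<open>w\<close> to
  \<open>s\<close> in both directions.\<close>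

lemma grown_connected:
  assumes "grown G xs" "u \<in> set xs" "v \<in> set xs"
  shows "(u, v) \<in> {(x, y). x \<rightarrow>\<^bsub>G\<^esub> y \<and> y \<in> set xs}\<^sup>*"
  using assms
proof (induction arbitrary: u v)
  case (single v)
  then show ?case by simp
next
  case (snoc xs s w)
  let ?R = "\<lambda>xs. {(x, y). x \<rightarrow>\<^bsub>G\<^esub> y \<and> y \<in> set xs}\<^sup>*"
  have mono: "?R xs \<subseteq> ?R (xs @ [w])"
    by (rule rtrancl_mono) auto
  have sw: "(s, w) \<in> ?R (xs @ [w])"
    using snoc.hyps by (intro r_into_rtrancl) simp
  have "w \<rightarrow>\<^bsub>G\<^esub> s"
    using snoc.hyps sym_arcs by (auto simp: symmetric_def dest: symD)
  then have ws: "(w, s) \<in> ?R (xs @ [w])"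
    using snoc.hyps by (intro r_into_rtrancl) simp
  have "(u, s) \<in> ?R (xs @ [w])"
    using snoc ws mono by (cases "u = w") (auto dest: snoc.IH)
  moreover have "(s, v) \<in> ?R (xs @ [w])"
    using snoc sw mono by (cases "v = w") (auto dest: snoc.IH)
  ultimately show ?case by (rule rtrancl_trans)
qed

text \<open>An unlabeled vertex must remain, since the process stops once everything is
  labeled.\<close>

lemma rw_state_move:
  assumes "rw_state G u (labeling_of xs) i" "grown G xs" "\<exists>x\<in>verts G. x \<notin> set xs"
    "u \<in> set xs" "v \<in> set xs"
  shows "rw_state G v (labeling_of xs) i"
  using grown_connected[OF assms(2,4,5)]
proof induction
  case base
  show ?case by fact
next
  case (step y z)
  show ?case
  proof (rule rw_state.revisit[OF step.IH])
    show "\<exists>x\<in>verts G. labeling_of xs x = None"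
      using assms(3) by (simp add: labeling_of_eq_None_iff)
    show "y \<rightarrow>\<^bsub>G\<^esub> z" "labeling_of xs z \<noteq> None"
      using step.hyps(2) by (simp_all add: labeling_of_eq_None_iff del: not_None_eq)
  qed
qed

text \<open>Only some position can be promised: after the last label the walk can no longer
  move.\<close>

lemma grown_rw_state:
  assumes "grown G xs"
  shows "\<exists>v\<in>set xs. rw_state G v (labeling_of xs) (length xs)"
  using assms
proof induction
  case (single v)
  then show ?case
    using rw_state.start[of v G] by (simp add: labeling_of_single del: fun_upd_apply)
next
  case (snoc xs s w)
  have w: "w \<in> verts G" using snoc.hyps by auto
  \<comment> \<open>\<open>w\<close> is still unlabeled, so the walk may go back to
    \<open>s\<close>.\<close>
  have "rw_state G s (labeling_of xs) (length xs)"
    using snoc w rw_state_move by metis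
  then have "rw_state G w ((labeling_of xs)(w \<mapsto> length xs + 1)) (length xs + 1)"
    using w snoc.hyps by (intro rw_state.discover) (auto simp: labeling_of_eq_None_iff)
  then show ?case
    using snoc.hyps by (simp add: labeling_of_snoc del: fun_upd_apply)
qed

lemma random_walk_labelings_eq:
  "random_walk_labelings G = labeling_of ` {xs. grown G xs \<and> set xs = verts G}"
proof (intro equalityI subsetI)
  fix f assume "f \<in> random_walk_labelings G"
  then obtain v i where "rw_state G v f i" and total: "\<forall>u\<in>verts G. f u \<noteq> None"
    by (auto simp: random_walk_labelings_def)
  then obtain xs where "grown G xs" "f = labeling_of xs"
    using rw_state_grown by blast
  then show "f \<in> labeling_of ` {xs. grown G xs \<and> set xs = verts G}"
    using total grown_subset by (auto simp: labeling_of_eq_None_iff)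
next
  fix f assume "f \<in> labeling_of ` {xs. grown G xs \<and> set xs = verts G}"
  then obtain xs where "grown G xs" "set xs = verts G" "f = labeling_of xs" by auto
  then show "f \<in> random_walk_labelings G"
    using grown_rw_state[of xs] labeling_of_eq_None_iff[of xs]
    unfolding random_walk_labelings_def by blast
qed

lemma num_random_walk_labelings_eq:
  "num_random_walk_labelings G = card {xs. grown G xs \<and> set xs = verts G}"
  unfolding num_random_walk_labelings_def random_walk_labelings_eq
  by (intro card_image inj_onI labeling_of_inj) (auto intro: grown_distinct)

end

section \<open>Counting completions of a partial labeling\<close>

text \<open>The past enters only through the unlabeled set \<open>U\<close>, which permits a
  recursion on sets. A first vertex has no labeled neighbor, so starts are summed separately in
  \<open>num_random_walk_labelings_sum\<close>.\<close>

primrec completes :: "('a, 'b) pre_digraph \<Rightarrow> 'a set \<Rightarrow> 'a list \<Rightarrow> bool" where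
  "completes G U [] \<longleftrightarrow> U = {}"
| "completes G U (x # xs) \<longleftrightarrow>
     x \<in> U \<and> (\<exists>s\<in>verts G - U. s \<rightarrow>\<^bsub>G\<^esub> x) \<and> completes G (U - {x}) xs"

definition num_completions :: "('a, 'b) pre_digraph \<Rightarrow> 'a set \<Rightarrow> nat" where
  "num_completions G U = card {xs. completes G U xs}"

definition frontier :: "('a, 'b) pre_digraph \<Rightarrow> 'a set \<Rightarrow> 'a set" where
  "frontier G U = {x \<in> U. \<exists>s\<in>verts G - U. s \<rightarrow>\<^bsub>G\<^esub> x}"

lemma completes_distinct: "completes G U xs \<Longrightarrow> distinct xs \<and> set xs = U"
  by (induction xs arbitrary: U) auto

lemma finite_completes: "finite U \<Longrightarrow> finite {xs. completes G U xs}"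
  by (rule finite_subset[OF _ finite_subset_distinct[of U]]) (auto dest: completes_distinct)

lemma num_completions_empty [simp]: "num_completions G {} = 1"
proof -
  have "{xs. completes G {} xs} = {[]}"
    by (auto dest: completes_distinct)
  then show ?thesis by (simp add: num_completions_def)
qed

lemma num_completions_step:
  assumes "finite U" "U \<noteq> {}"
  shows "num_completions G U = (\<Sum>x\<in>frontier G U. num_completions G (U - {x}))"
proof -
  have "{xs. completes G U xs} =
      (\<Union>x\<in>frontier G U. (#) x ` {xs. completes G (U - {x}) xs})" (is "?L = ?R")
  proof (rule set_eqI)
    fix xs show "xs \<in> ?L \<longleftrightarrow> xs \<in> ?R"
      using assms by (cases xs) (auto simp: frontier_def)
  qed
  moreover have "card ?R = (\<Sum>x\<in>frontier G U. card ((#) x ` {xs. completes G (U - {x}) xs}))"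
    using assms by (intro card_UN_disjoint) (auto simp: frontier_def finite_completes)
  ultimately show ?thesis
    by (simp add: num_completions_def card_image)
qed

context pseudo_graph
begin

text \<open>The induction moves the head of \<open>ys\<close> to the end of \<open>xs\<close>, so
  the labeled part always stays grown.\<close>

lemma grown_append_iff_completes:
  assumes "grown G xs"
  shows "grown G (xs @ ys) \<and> set (xs @ ys) = verts G \<longleftrightarrow> completes G (verts G - set xs) ys"
  using assms
proof (induction ys arbitrary: xs)
  case Nil
  then show ?case using grown_subset by auto
next
  case (Cons y ys)
  have sub: "verts G - (verts G - set xs) = set xs"
    using Cons.prems grown_subset by blast
  have pre: "grown G (xs @ y # ys) \<Longrightarrow> grown G (xs @ [y])"
    using grown_prefix[of G "xs @ [y]" ys] by simp
  have step: "grown G (xs @ [y]) \<longleftrightarrow> y \<in> verts G - set xs \<and> (\<exists>s\<in>set xs. s \<rightarrow>\<^bsub>G\<^esub> y)"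
    using Cons.prems grown_not_Nil[OF Cons.prems] by (auto simp: grown_snoc_iff)
  show ?case
  proof (cases "grown G (xs @ [y])")
    case True
    have "verts G - set (xs @ [y]) = verts G - set xs - {y}" by auto
    then show ?thesis
      using Cons.IH[OF True] True step sub by simp
  next
    case False
    then show ?thesis using step sub pre by auto
  qed
qed

lemma num_random_walk_labelings_sum:
  "num_random_walk_labelings G = (\<Sum>v\<in>verts G. num_completions G (verts G - {v}))"
proof -
  have "{xs. grown G xs \<and> set xs = verts G} =
      (\<Union>v\<in>verts G. (#) v ` {xs. completes G (verts G - {v}) xs})" (is "?L = ?R")
  proof (rule set_eqI)
    fix xs
    show "xs \<in> ?L \<longleftrightarrow> xs \<in> ?R"
    proof (cases xs)
      case Nil
      then show ?thesis by (auto dest: grown_not_Nil)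
    next
      case (Cons v ys)
      show ?thesis
      proof (cases "v \<in> verts G")
        case True
        then show ?thesis
          using grown_append_iff_completes[OF grown.single[OF True], of ys] Cons by auto
      next
        case False
        then show ?thesis using Cons by auto
      qed
    qed
  qed
  moreover have "card ?R = (\<Sum>v\<in>verts G. card ((#) v ` {xs. completes G (verts G - {v}) xs}))"
    by (intro card_UN_disjoint) (auto simp: finite_completes)
  ultimately show ?thesis
    by (simp add: num_random_walk_labelings_eq num_completions_def card_image)
qed

end

section \<open>The tadpole graph\<close>

locale tadpole =
  fixes m n :: nat
  assumes m: "m \<ge> 3" and n: "n \<ge> 1"
begin

text \<open>
  The sets A and B hold the unlabeled vertices of the cycle and of the path.
\<close>

definition N :: "nat set \<Rightarrow> nat set \<Rightarrow> nat" where
  "N A B = num_completions (tadpole_graph m n) (A <+> B)"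

text \<open>The modulus is unfolded into an explicit wrap-around between \<open>0\<close> and
  \<open>m - 1\<close>, which suits arithmetic on intervals. The clause \<open>0 \<notin> B\<close>
  is the bridge, crossed from the path.\<close>

definition cycle_frontier :: "nat set \<Rightarrow> nat set \<Rightarrow> nat set" where
  "cycle_frontier A B = {i\<in>A. (i = 0 \<and> 0 \<notin> B) \<or>
     (\<exists>j<m. j \<notin> A \<and> (i = Suc j \<or> j = Suc i \<or> (i = 0 \<and> j = m - 1) \<or> (j = 0 \<and> i = m - 1)))}"

definition path_frontier :: "nat set \<Rightarrow> nat set \<Rightarrow> nat set" where
  "path_frontier A B = {k\<in>B. (k = 0 \<and> 0 \<notin> A) \<or> (\<exists>l<n. l \<notin> B \<and> (k = Suc l \<or> l = Suc k))}"

lemma cycle_adjacent_iff: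
  assumes "i < m" "j < m"
  shows "i = Suc j mod m \<or> j = Suc i mod m \<longleftrightarrow>
    i = Suc j \<or> j = Suc i \<or> (i = 0 \<and> j = m - 1) \<or> (j = 0 \<and> i = m - 1)"
proof -
  have *: "Suc k mod m = (if k = m - 1 then 0 else Suc k)" if "k < m" for k
    using that m by auto
  show ?thesis
    unfolding *[OF assms(1)] *[OF assms(2)] using assms m by auto
qed

lemma frontier_tadpole_graph:
  assumes "A \<subseteq> {..<m}" "B \<subseteq> {..<n}"
  shows "frontier (tadpole_graph m n) (A <+> B) = cycle_frontier A B <+> path_frontier A B"
proof -
  have verts: "verts (with_proj (tadpole_graph m n)) - (A <+> B) = ({..<m} - A) <+> ({..<n} - B)"
    by (auto simp: pverts_tadpole_graph)
  have bex: "(\<exists>s\<in>X <+> Y. P s) \<longleftrightarrow> (\<exists>j\<in>X. P (Inl j)) \<or> (\<exists>l\<in>Y. P (Inr l))"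
    for X Y and P :: "nat + nat \<Rightarrow> bool"
    by auto
  have "Inl i \<in> frontier (tadpole_graph m n) (A <+> B) \<longleftrightarrow> i \<in> cycle_frontier A B" for i
  proof -
    have "Inl i \<in> frontier (tadpole_graph m n) (A <+> B) \<longleftrightarrow>
        i \<in> A \<and> ((\<exists>j<m. j \<notin> A \<and> (i = Suc j mod m \<or> j = Suc i mod m)) \<or> (i = 0 \<and> 0 \<notin> B))"
      using assms n unfolding frontier_def verts mem_Collect_eq bex
      by (auto simp: parcs_tadpole_graph_iff)
    also have "\<dots> \<longleftrightarrow> i \<in> cycle_frontier A B"
      using assms cycle_adjacent_iff unfolding cycle_frontier_def by blast
    finally show ?thesis .
  qed
  moreover have "Inr k \<in> frontier (tadpole_graph m n) (A <+> B) \<longleftrightarrow> k \<in> path_frontier A B" for k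
    using assms m n unfolding frontier_def verts path_frontier_def mem_Collect_eq bex
    by (auto simp: parcs_tadpole_graph_iff)
  ultimately show ?thesis
    by (intro set_eqI, rename_tac x, case_tac x) auto
qed

lemma N_empty [simp]: "N {} {} = 1"
proof -
  have "({} <+> {} :: (nat + nat) set) = {}" by simp
  then show ?thesis by (simp only: N_def num_completions_empty)
qed

lemma N_step:
  assumes "A \<subseteq> {..<m}" "B \<subseteq> {..<n}" "A \<noteq> {} \<or> B \<noteq> {}"
  shows "N A B = (\<Sum>i\<in>cycle_frontier A B. N (A - {i}) B) + (\<Sum>k\<in>path_frontier A B. N A (B - {k}))"
proof -
  have fin: "finite A" "finite B"
    using assms(1,2) finite_subset by blast+
  then have fin': "finite (cycle_frontier A B)" "finite (path_frontier A B)"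
    by (simp_all add: cycle_frontier_def path_frontier_def)
  have "(A <+> B) - {Inl i} = (A - {i}) <+> B" "(A <+> B) - {Inr i} = A <+> (B - {i})" for i
    by auto
  then show ?thesis
    using assms fin fin' unfolding N_def
    by (subst num_completions_step) (auto simp: frontier_tadpole_graph sum.Plus)
qed

section \<open>Completions once the vertex of degree three is labeled\<close>

text \<open>
  The number of completions when the vertex of degree three is labeled and r cycle vertices and s
  path vertices are not; \<open>r = 0\<close> is separate because \<open>r - 1\<close> truncates.
\<close>

definition junction_count :: "nat \<Rightarrow> nat \<Rightarrow> nat" where
  "junction_count r s = (if r = 0 then 1 else 2 ^ (r - 1) * ((r + s) choose s))"

lemma junction_count_0 [simp]: "junction_count 0 s = 1"
  and junction_count_Suc: "junction_count (Suc r) s = 2 ^ r * ((Suc r + s) choose s)"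
  by (simp_all add: junction_count_def)

text \<open>An arc that avoids vertex \<open>0\<close> can be entered only at its ends. These
  coincide for a single vertex, so the last cycle vertex gives no factor 2.\<close>

lemma cycle_frontier_interval:
  assumes "1 \<le> c" "c < d" "d \<le> m"
  shows "cycle_frontier {c..<d} B = {c, d - 1}"
proof (intro equalityI subsetI)
  fix i assume "i \<in> {c, d - 1}"
  moreover have "c \<in> cycle_frontier {c..<d} B"
    using assms unfolding cycle_frontier_def
    by (auto intro!: exI[of _ "c - 1"])
  \<comment> \<open>The labeled neighbor is \<open>d\<close>, or \<open>0\<close> by wrap-around if
    \<open>d = m\<close>; \<open>1 \<le> c\<close> keeps \<open>0\<close> outside the
    interval.\<close>
  moreover have "d - 1 \<in> cycle_frontier {c..<d} B"
    using assms unfolding cycle_frontier_def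
    by (cases "d = m") (auto intro: exI[of _ 0] exI[of _ d])
  ultimately show "i \<in> cycle_frontier {c..<d} B" by blast
qed (use assms in \<open>auto simp: cycle_frontier_def\<close>)

lemma path_frontier_interval:
  assumes "0 \<notin> A" "k < n"
  shows "path_frontier A {k..<n} = {k}"
proof -
  have "k \<in> path_frontier A {k..<n}"
    using assms unfolding path_frontier_def
    by (cases k) (auto intro: exI[of _ "k - 1"])
  then show ?thesis
    by (auto simp: path_frontier_def)
qed

lemma N_junction_labeled:
  assumes "1 \<le> c" "c + r \<le> m" "k + s = n"
  shows "N {c..<c + r} {k..<n} = junction_count r s"
  using assms
proof (induction "r + s" arbitrary: c r k s)
  case 0
  then show ?case by simp
next
  case (Suc t)
  \<comment> \<open>Removing either end leaves an arc of the same length, hence the factor 2. For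
    \<open>r = 1\<close> the ends coincide and \<open>junction_count 0 s = 1\<close>
    remains.\<close>
  have cyc: "(\<Sum>i\<in>cycle_frontier {c..<c + r} {k..<n}. N ({c..<c + r} - {i}) {k..<n}) =
      (case r of 0 \<Rightarrow> 0 | Suc 0 \<Rightarrow> 1 | Suc (Suc r') \<Rightarrow> 2 * junction_count (Suc r') s)"
  proof (cases r)
    case 0
    then show ?thesis by (simp add: cycle_frontier_def)
  next
    case (Suc r')
    have left: "N ({c..<c + r} - {c}) {k..<n} = junction_count r' s"
    proof -
      have "{c..<c + r} - {c} = {Suc c..<Suc c + r'}"
        using Suc by auto
      then show ?thesis
        using Suc.hyps(1)[of r' s "Suc c" k] Suc.hyps(2) Suc.prems Suc by simp
    qed
    have right: "N ({c..<c + r} - {c + r - 1}) {k..<n} = junction_count r' s"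
    proof -
      have "{c..<c + r} - {c + r - 1} = {c..<c + r'}"
        using Suc by auto
      then show ?thesis
        using Suc.hyps(1)[of r' s c k] Suc.hyps(2) Suc.prems Suc by simp
    qed
    have "cycle_frontier {c..<c + r} {k..<n} = {c, c + r - 1}"
      using Suc Suc.prems by (intro cycle_frontier_interval) auto
    with left right Suc show ?thesis
      by (cases r') (simp_all split: nat.splits)
  qed
  have path: "(\<Sum>l\<in>path_frontier {c..<c + r} {k..<n}. N {c..<c + r} ({k..<n} - {l})) =
      (case s of 0 \<Rightarrow> 0 | Suc s' \<Rightarrow> junction_count r s')"
  proof (cases s)
    case 0
    then show ?thesis using Suc.prems by (simp add: path_frontier_def)
  next
    case (Suc s')
    have "{k..<n} - {k} = {Suc k..<n}" by auto
    moreover have "path_frontier {c..<c + r} {k..<n} = {k}"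
      using Suc Suc.prems by (intro path_frontier_interval) auto
    ultimately show ?thesis
      using Suc.hyps(1)[of r s' c "Suc k"] Suc.hyps(2) Suc.prems Suc by simp
  qed
  have "N {c..<c + r} {k..<n} =
      (case r of 0 \<Rightarrow> 0 | Suc 0 \<Rightarrow> 1 | Suc (Suc r') \<Rightarrow> 2 * junction_count (Suc r') s) +
      (case s of 0 \<Rightarrow> 0 | Suc s' \<Rightarrow> junction_count r s')"
    using Suc.hyps(2) Suc.prems by (subst N_step) (auto simp: cyc path)
  \<comment> \<open>For positive \<open>r\<close> and \<open>s\<close> this is Pascal's rule times
    \<open>2 ^ (r - 1)\<close>.\<close>
  also have "\<dots> = junction_count r s"
    using Suc.hyps(2)
    by (auto simp: junction_count_Suc algebra_simps split: nat.splits)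
  finally show ?case .
qed

section \<open>Starts on the path\<close>

text \<open>The labeled segment is \<open>{a..<b}\<close>. The \<open>s\<close> outer vertices come
  in forced order and interleave freely with the other \<open>m + a\<close>; among those,
  \<open>a\<close> path vertices and vertex \<open>0\<close> are forced, and the arc of
  \<open>m - 1\<close> vertices yields \<open>2 ^ (m - 2)\<close>.\<close>

lemma N_path_start:
  assumes "a < b" "b + s = n"
  shows "N {..<m} ({..<a} \<union> {b..<n}) = 2 ^ (m - 2) * ((m + a + s) choose s)"
  using assms
proof (induction "a + s" arbitrary: a b s rule: less_induct)
  case less
  let ?B = "{..<a} \<union> {b..<n}"
  \<comment> \<open>The next vertex on the bridge side is cycle vertex \<open>0\<close> if
    \<open>a = 0\<close>, else path vertex \<open>a - 1\<close>. This and \<open>right\<close> are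
    the two summands of Pascal's rule.\<close>
  have left: "(\<Sum>i\<in>cycle_frontier {..<m} ?B. N ({..<m} - {i}) ?B) +
      (\<Sum>k\<in>path_frontier {..<m} ?B \<inter> {..<a}. N {..<m} (?B - {k})) =
      2 ^ (m - 2) * ((m + a + s - 1) choose s)"
  proof (cases a)
    case 0
    then have "cycle_frontier {..<m} ?B = {0}"
      using m less.prems by (auto simp: cycle_frontier_def)
    moreover have "{..<m} - {0} = {1..<1 + (m - 1)}"
      using m by auto
    moreover have "junction_count (m - 1) s = 2 ^ (m - 2) * ((m + s - 1) choose s)"
      using m by (simp add: junction_count_def numeral_2_eq_2)
    ultimately show ?thesis
      using N_junction_labeled[of 1 "m - 1" b s] less.prems 0 m
      by (simp del: One_nat_def)
  next
    case (Suc a')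
    have "cycle_frontier {..<m} ?B = {}"
      using Suc by (auto simp: cycle_frontier_def)
    moreover have "path_frontier {..<m} ?B \<inter> {..<a} = {a'}"
      using Suc less.prems m by (auto simp: path_frontier_def intro!: exI[of _ a])
    moreover have "?B - {a'} = {..<a'} \<union> {b..<n}"
      using Suc less.prems by auto
    ultimately show ?thesis
      using less.hyps[of a' s b] less.prems Suc by simp
  qed
  have right: "(\<Sum>k\<in>path_frontier {..<m} ?B \<inter> {b..<n}. N {..<m} (?B - {k})) =
      (case s of 0 \<Rightarrow> 0 | Suc s' \<Rightarrow> 2 ^ (m - 2) * ((m + a + s') choose s'))"
  proof (cases s)
    case 0
    then show ?thesis using less.prems by simp
  next
    case (Suc s')
    have "path_frontier {..<m} ?B \<inter> {b..<n} = {b}"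
      using Suc less.prems m by (auto simp: path_frontier_def intro!: exI[of _ "b - 1"])
    moreover have "?B - {b} = {..<a} \<union> {Suc b..<n}"
      using less.prems by auto
    ultimately show ?thesis
      using less.hyps[of a s' "Suc b"] less.prems Suc by simp
  qed
  have split: "path_frontier {..<m} ?B =
      (path_frontier {..<m} ?B \<inter> {..<a}) \<union> (path_frontier {..<m} ?B \<inter> {b..<n})"
    by (auto simp: path_frontier_def)
  have "(\<Sum>k\<in>path_frontier {..<m} ?B. N {..<m} (?B - {k})) =
      (\<Sum>k\<in>path_frontier {..<m} ?B \<inter> {..<a}. N {..<m} (?B - {k})) +
      (\<Sum>k\<in>path_frontier {..<m} ?B \<inter> {b..<n}. N {..<m} (?B - {k}))"
    using less.prems by (subst split, subst sum.union_disjoint) auto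
  moreover have "N {..<m} ?B = (\<Sum>i\<in>cycle_frontier {..<m} ?B. N ({..<m} - {i}) ?B) +
      (\<Sum>k\<in>path_frontier {..<m} ?B. N {..<m} (?B - {k}))"
    using m less.prems by (intro N_step) (auto simp: lessThan_empty_iff)
  ultimately have "N {..<m} ?B = 2 ^ (m - 2) * ((m + a + s - 1) choose s) +
      (case s of 0 \<Rightarrow> 0 | Suc s' \<Rightarrow> 2 ^ (m - 2) * ((m + a + s') choose s'))"
    using left right by simp
  also have "\<dots> = 2 ^ (m - 2) * ((m + a + s) choose s)"
    by (auto simp: algebra_simps split: nat.splits)
  finally show ?case .
qed

section \<open>Starts on the cycle\<close>

text \<open>
  The labeled vertices form an arc of the cycle, with p and q unlabeled vertices between its two
  ends and the unlabeled vertex of degree three. In the case \<open>p = q = 0\<close> both ends are adjacent to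
  that vertex, which is still a single choice.
\<close>

fun arc_count :: "nat \<Rightarrow> nat \<Rightarrow> nat" where
  "arc_count 0 0 = 1"
| "arc_count 0 (Suc q) = junction_count (Suc q) n + arc_count 0 q"
| "arc_count (Suc p) 0 = arc_count p 0 + junction_count (Suc p) n"
| "arc_count (Suc p) (Suc q) = arc_count p (Suc q) + arc_count (Suc p) q"

text \<open>The labeled arc is \<open>{Suc p..<d}\<close>; its upper neighbor wraps to
  \<open>0\<close> when \<open>d = m\<close>, and both neighbors are \<open>0\<close> if also
  \<open>p = 0\<close>. The whole path is unlabeled, so nothing enters over the bridge.\<close>

lemma cycle_frontier_arc:
  assumes "Suc p < d" "d \<le> m"
  shows "cycle_frontier ({..<Suc p} \<union> {d..<m}) {..<n} = {p, if d < m then d else 0}"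
proof -
  let ?A = "{..<Suc p} \<union> {d..<m}"
  have "p \<in> cycle_frontier ?A {..<n}"
    using assms by (auto simp: cycle_frontier_def intro!: exI[of _ "Suc p"])
  moreover have "(if d < m then d else 0) \<in> cycle_frontier ?A {..<n}"
    using assms by (auto simp: cycle_frontier_def intro!: exI[of _ "d - 1"])
  moreover have "i \<in> {p, if d < m then d else 0}" if "i \<in> cycle_frontier ?A {..<n}" for i
  proof -
    from that n obtain j where "j < m" "Suc p \<le> j" "j < d" "i \<le> p \<or> d \<le> i" "i < m"
      "i = Suc j \<or> j = Suc i \<or> (i = 0 \<and> j = m - 1) \<or> (j = 0 \<and> i = m - 1)"
      using assms by (fastforce simp: cycle_frontier_def)
    then show ?thesis
      using assms by (cases "d < m") auto
  qed
  ultimately show ?thesis by blast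
qed

lemma path_frontier_arc: "0 \<in> A \<Longrightarrow> path_frontier A {..<n} = {}"
  by (auto simp: path_frontier_def)

text \<open>Either the labeled arc grows by one vertex and still avoids \<open>0\<close>, or
  \<open>0\<close> gets labeled and \<open>N_junction_labeled\<close> counts the rest: one arc and
  the full path.\<close>

lemma N_cycle_start:
  assumes "Suc p < d" "d + q = m"
  shows "N ({..<Suc p} \<union> {d..<m}) {..<n} = arc_count p q"
  using assms
proof (induction p q arbitrary: d rule: arc_count.induct)
  case 1
  let ?A = "{..<Suc 0} \<union> {d..<m}"
  have "cycle_frontier ?A {..<n} = {0}"
    using 1 cycle_frontier_arc[of 0 d] by simp
  then have "N ?A {..<n} = (\<Sum>i\<in>{0}. N (?A - {i}) {..<n})"
    using 1 by (subst N_step) (auto simp: path_frontier_arc)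
  moreover have "?A - {0} = {}"
    using 1 by auto
  ultimately show ?case
    using N_junction_labeled[of 1 0 0 n] m by (simp add: atLeast0LessThan)
next
  case (2 q)
  let ?A = "{..<Suc 0} \<union> {d..<m}"
  have "N ?A {..<n} = (\<Sum>i\<in>{0, d}. N (?A - {i}) {..<n})"
    using 2 by (subst N_step) (auto simp: cycle_frontier_arc path_frontier_arc)
  moreover have "?A - {0} = {d..<d + Suc q}" "?A - {d} = {..<Suc 0} \<union> {Suc d..<m}"
    using 2 by auto
  ultimately show ?case
    using 2 N_junction_labeled[of d "Suc q" 0 n] by (simp add: atLeast0LessThan)
next
  case (3 p)
  let ?A = "{..<Suc (Suc p)} \<union> {d..<m}"
  have "cycle_frontier ?A {..<n} = {Suc p, 0}"
    using 3 cycle_frontier_arc[of "Suc p" d] by simp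
  then have "N ?A {..<n} = (\<Sum>i\<in>{Suc p, 0}. N (?A - {i}) {..<n})"
    using 3 by (subst N_step) (auto simp: path_frontier_arc)
  moreover have "?A - {0} = {1..<1 + Suc p}" "?A - {Suc p} = {..<Suc p} \<union> {d..<m}"
    using 3 by auto
  ultimately show ?case
    using 3 N_junction_labeled[of 1 "Suc p" 0 n] by (simp add: atLeast0LessThan)
next
  case (4 p q)
  let ?A = "{..<Suc (Suc p)} \<union> {d..<m}"
  have "N ?A {..<n} = (\<Sum>i\<in>{Suc p, d}. N (?A - {i}) {..<n})"
    using 4 by (subst N_step) (auto simp: cycle_frontier_arc path_frontier_arc)
  moreover have "?A - {Suc p} = {..<Suc p} \<union> {d..<m}"
    "?A - {d} = {..<Suc (Suc p)} \<union> {Suc d..<m}"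
    using 4 by auto
  ultimately show ?case
    using 4 by simp
qed

text \<open>Here \<open>t\<close> is the number of unlabeled cycle vertices other than
  \<open>0\<close>, and \<open>p\<close> ranges over the positions of the labeled arc. Writing
  \<open>S t\<close> for the sum, \<open>S (Suc t) = 2 * S t + 2 * junction_count (Suc t) n\<close>,
  which Pascal's rule solves.\<close>

lemma sum_arc_count: "(\<Sum>p\<le>t. arc_count p (t - p)) = 2 ^ t * ((t + n + 1) choose (n + 1))"
proof (induction t)
  case 0
  then show ?case by simp
next
  case (Suc t)
  let ?J = "junction_count (Suc t) n"
  \<comment> \<open>L and R count the continuations that extend the arc at its left and right end.\<close>
  define L where "L p = (if p = 0 then ?J else arc_count (p - 1) (Suc t - p))" for p
  define R where "R p = (if p = Suc t then ?J else arc_count p (t - p))" for p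
  \<comment> \<open>At \<open>p = 0\<close> or \<open>p = Suc t\<close> one end of the arc touches
    vertex \<open>0\<close>, and extending there labels it: this is the boundary value
    \<open>?J\<close>.\<close>
  have "arc_count p (Suc t - p) = L p + R p" if "p \<le> Suc t" for p
  proof -
    obtain q where "Suc t = p + q"
      using \<open>p \<le> Suc t\<close> le_Suc_ex by blast
    moreover from this have "t = p + (q - 1)" if "q > 0"
      using that by simp
    ultimately show ?thesis
      unfolding L_def R_def by (cases p; cases q) auto
  qed
  then have "(\<Sum>p\<le>Suc t. arc_count p (Suc t - p)) = (\<Sum>p\<le>Suc t. L p) + (\<Sum>p\<le>Suc t. R p)"
    by (simp add: sum.distrib)
  \<comment> \<open>Left extensions are indexed by \<open>p - 1\<close>, so a shift of the index
    recovers the sum for \<open>t\<close>.\<close>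
  also have "(\<Sum>p\<le>Suc t. L p) = ?J + (\<Sum>p\<le>t. arc_count p (t - p))"
    by (subst sum.atMost_Suc_shift) (simp add: L_def)
  also have "(\<Sum>p\<le>Suc t. R p) = (\<Sum>p\<le>t. arc_count p (t - p)) + ?J"
    by (simp add: R_def)
  finally show ?case
    by (simp add: Suc.IH junction_count_Suc algebra_simps)
qed

section \<open>Summation over all starts\<close>

lemma num_labelings:
  "num_random_walk_labelings (tadpole_graph m n) =
    2 ^ (m - 2) * (((m + n) choose (n + 1)) + (\<Sum>k = 0..n - 1. (m + n - 1) choose (k + m)))"
proof -
  let ?T = "with_proj (tadpole_graph m n)"
  interpret T: pair_graph "tadpole_graph m n"
    using m n by (rule pair_graph_tadpole_graph)
  have verts: "verts ?T = {..<m} <+> {..<n}"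
    by (auto simp: pverts_tadpole_graph)
  have "num_random_walk_labelings ?T = (\<Sum>v\<in>verts ?T. num_completions ?T (verts ?T - {v}))"
    using T.num_random_walk_labelings_sum by simp
  also have "\<dots> = (\<Sum>i<m. N ({..<m} - {i}) {..<n}) + (\<Sum>k<n. N {..<m} ({..<n} - {k}))"
  proof -
    have "({..<m} <+> {..<n}) - {Inl i} = ({..<m} - {i}) <+> {..<n}"
      "({..<m} <+> {..<n}) - {Inr i} = {..<m} <+> ({..<n} - {i})" for i
      by auto
    then show ?thesis unfolding verts N_def by (simp add: sum.Plus)
  qed
  \<comment> \<open>Start \<open>0\<close> contributes \<open>(m + n - 1) choose n\<close> and the
    other cycle vertices together \<open>(m + n - 1) choose (n + 1)\<close>, each times
    \<open>2 ^ (m - 2)\<close>; Pascal's rule merges them.\<close>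
  also have "(\<Sum>i<m. N ({..<m} - {i}) {..<n}) = 2 ^ (m - 2) * ((m + n) choose (n + 1))"
  proof -
    obtain t where t: "m = Suc (Suc t)"
      using m by (intro that[of "m - 2"]) simp
    have "N ({..<m} - {Suc p}) {..<n} = arc_count p (t - p)" if "p \<le> t" for p
    proof -
      \<comment> \<open>A start is a labeled arc of one vertex, so \<open>d = Suc (Suc p)\<close>
        and \<open>q = t - p\<close>.\<close>
      have "{..<m} - {Suc p} = {..<Suc p} \<union> {Suc (Suc p)..<m}"
        using that t by auto
      then show ?thesis
        using N_cycle_start[of p "Suc (Suc p)" "t - p"] that t by simp
    qed
    moreover have "N ({..<m} - {0}) {..<n} = 2 ^ t * ((Suc t + n) choose n)"
    proof -
      have "{..<m} - {0} = {1..<1 + Suc t}" "{..<n} = {0..<n}"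
        using t by auto
      then show ?thesis
        using N_junction_labeled[of 1 "Suc t" 0 n] t by (simp add: junction_count_Suc)
    qed
    moreover have "(\<Sum>i<m. N ({..<m} - {i}) {..<n}) =
        N ({..<m} - {0}) {..<n} + (\<Sum>p\<le>t. N ({..<m} - {Suc p}) {..<n})"
      unfolding t by (simp only: lessThan_Suc_atMost sum.atMost_Suc_shift)
    ultimately show ?thesis
      by (simp add: sum_arc_count t algebra_simps)
  qed
  also have "(\<Sum>k<n. N {..<m} ({..<n} - {k})) =
      2 ^ (m - 2) * (\<Sum>k = 0..n - 1. (m + n - 1) choose (k + m))"
  proof -
    have "N {..<m} ({..<n} - {k}) = 2 ^ (m - 2) * ((m + n - 1) choose (k + m))" if "k < n" for k
    proof -
      have "{..<n} - {k} = {..<k} \<union> {Suc k..<n}"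
        using that by auto
      \<comment> \<open>Beyond path vertex \<open>k\<close> lie \<open>n - Suc k\<close> vertices;
        the complementary index is \<open>k + m\<close>.\<close>
      moreover have "(m + n - 1) choose (n - Suc k) = (m + n - 1) choose (k + m)"
        using that
        by (subst binomial_symmetric) (auto intro: arg_cong[of _ _ "(choose) (m + n - 1)"])
      moreover have "m + k + (n - Suc k) = m + n - 1"
        using that by simp
      ultimately show ?thesis
        using N_path_start[of k "Suc k" "n - Suc k"] that by simp
    qed
    then have "(\<Sum>k<n. N {..<m} ({..<n} - {k})) =
        (\<Sum>k<n. 2 ^ (m - 2) * ((m + n - 1) choose (k + m)))"
      by (intro sum.cong) auto
    moreover have "{..<n} = {0..n - 1}"
      using n by auto
    ultimately show ?thesis
      by (simp add: sum_distrib_left)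
  qed
  finally show ?thesis
    by (simp add: distrib_left)
qed

end

theorem theorem6:
  fixes m n :: nat
  assumes "m \<ge> 3" and "n \<ge> 1"
  shows "num_random_walk_labelings (tadpole_graph m n) =
    2 ^ (m - 2) * (((m + n) choose (n + 1)) + (\<Sum>k = 0..n - 1. (m + n - 1) choose (k + m)))"
  using assms by (intro tadpole.num_labelings tadpole.intro)

end
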